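(* Let $N\ge 2$, let $(X_1(t),\ldots,X_N(t))_{t\ge 0}$ be an $N$-dimensional Brownian motion with drifts $\mu_i\in\mathbb R$, volatilities $\sigma_i>0$, starting point $(x_1,\ldots,x_N)\in\mathbb R^N$ and pairwise correlations of absolute value $<1$. Let $(b_1,\ldots,b_N)\in\mathbb R^N$ with $b_i\ne x_i$ and $\frac{\mu_i}{b_i-x_i}\ge 0$ for all $i$. Let $\tau_i=\inf\{t>0: X_i(t)=b_i\}$ and denote by $f$ the joint density of $(\tau_1,\ldots,\tau_N)$. For $\tau>0$ put $$H_i(\tau)=\frac{(\mu_i\tau-(b_i-x_i))^2}{\sigma_i^2\tau}.$$ Let $(\chi_1^2,\ldots,\chi_N^2)$ be a vector of Chi-squared random variables with one degree of freedom satisfying $$(\chi_1^2,\ldots,\chi_N^2)\sim (H_1(\tau_1),\ldots,H_N(\tau_N)).$$ For $i=1,\ldots,N$: if $\mu_i\ne 0$, set $$X_{i1}=\frac{b_i-x_i}{\mu_i}+\frac{\sigma_i^2\chi_i^2}{2\mu_i^2}-\frac{\sigma_i|\chi_i|}{2\mu_i^2}\sqrt{4\mu_i(b_i-x_i)+\sigma_i^2\chi_i^2},\qquad X_{i2}=\frac{(b_i-x_i)^2}{\mu_i^2X_{i1}};$$ if $\mu_i=0$, set $$X_{i1}=X_{i2}=\frac{(b_i-x_i)^2}{\sigma_i^2\chi_i^2}.$$ For $(u_1,\ldots,u_N)\in\{1,2\}^N$ define $S_u=\{1,2\}^N\setminus\{(u_1,\ldots,u_N)\}$ and $$p_{u_1\cdots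 u_N}=\bigg(1+\sum_{(i_1,\ldots,i_N)\in S_u}\Big(\prod_{k=1}^N\Big|\frac{H_k'(X_{ku_k})}{H_k'(X_{ki_k})}\Big|\Big)\frac{f(X_{1i_1},\ldots,X_{Ni_N})}{f(X_{1u_1},\ldots,X_{Nu_N})}\bigg)^{-1}.$$ Let $\{I_{u_1\cdots u_N}\}_{u_1,\ldots,u_N\in\{1,2\}}$ be any partition of the interval $[0,1]$ satisfying $$\mathbb P\big(\lambda(I_{u_1\cdots u_N})=p_{u_1\cdots u_N}\big)=1,$$ where $\lambda$ is the Lebesgue measure on $\mathbb R$. Then $$(\tau_1,\ldots,\tau_N)\sim\sum_{u_1,\ldots,u_N\in\{1,2\}}(X_{1u_1},\ldots,X_{Nu_N})\,\mathbf 1_{I_{u_1\cdots u_N}}(U),$$ where $U$ is uniformly distributed on $(0,1)$ and independent of $(\chi_1^2,\ldots,\chi_N^2)$.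
   Context: The process satisfies $dX_k(t)=\mu_k\,dt+\sigma_k\,dW_k(t)$, $X_k(0)=x_k$, where the $W_k$ are standard (possibly correlated) Brownian motions; $|\mathrm{Corr}(X_i(t),X_j(t))|<1$ for $i\neq j$. The symbol $\sim$ between random vectors means equality in distribution. $|\chi_i|=\sqrt{\chi_i^2}$, and $H_k'$ is the derivative of $H_k$. The numbers $p_{u_1\cdots u_N}$ are random variables (functions of $(\chi_1^2,\ldots,\chi_N^2)$), so the partition of $[0,1]$ is a random partition. *)

theory Defs
  imports "HOL-Probability.Probability"
begin

text \<open>The law \<open>N(0, v)\<close> for \<open>v \<ge> 0\<close>. It is a push-forward, not a density, because the linear
  combinations used below may have variance \<open>0\<close> (point mass at \<open>0\<close>).\<close>

definition centered_normal :: "real \<Rightarrow> real measure" where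
  "centered_normal v = distr std_normal_distribution borel (\<lambda>z. sqrt v * z)"

definition chi_square_1 :: "real measure" where
  "chi_square_1 = distr std_normal_distribution borel (\<lambda>z. z\<^sup>2)"

text \<open>A vector of possibly correlated standard Brownian motions \<open>W\<^sub>k\<close>, indexed by the finite type
  \<open>'n\<close>, that together form an \<open>N\<close>-dimensional Brownian motion started at \<open>0\<close>. The matrix \<open>R\<close> is the
  correlation matrix; it may be singular. The increment over \<open>[s, t]\<close> is jointly Gaussian with mean
  \<open>0\<close> and covariance \<open>(t - s) R\<close>, i.e. every linear combination of its components is normal with the
  corresponding variance.\<close>

definition correlated_brownian_motion ::
    "'a measure \<Rightarrow> (real \<Rightarrow> 'a \<Rightarrow> real ^ 'n) \<Rightarrow> bool" where
  "correlated_brownian_motion M W \<longleftrightarrow>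
     prob_space M \<and>
     (\<forall>t\<ge>0. W t \<in> borel_measurable M) \<and>
     (AE \<omega> in M. W 0 \<omega> = 0) \<and>
     (AE \<omega> in M. continuous_on {0..} (\<lambda>t. W t \<omega>)) \<and>
     (\<forall>n (t :: nat \<Rightarrow> real). 0 \<le> t 0 \<and> (\<forall>i<n. t i < t (Suc i)) \<longrightarrow>
        prob_space.indep_vars M (\<lambda>_. borel) (\<lambda>i \<omega>. W (t (Suc i)) \<omega> - W (t i) \<omega>) {..<n}) \<and>
     (\<exists>R :: real ^ 'n ^ 'n. transpose R = R \<and> (\<forall>k. R $ k $ k = 1) \<and>
        (\<forall>s t a. 0 \<le> s \<and> s < t \<longrightarrow>
           distr M borel (\<lambda>\<omega>. a \<bullet> (W t \<omega> - W s \<omega>)) = centered_normal ((t - s) * (a \<bullet> (R *v a)))))"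

text \<open>The (strong) solution of \<open>dX\<^sub>k = \<mu>\<^sub>k dt + \<sigma>\<^sub>k dW\<^sub>k\<close>, \<open>X\<^sub>k(0) = x\<^sub>k\<close>; as the coefficients are
  constant, the integral form of the equation is the explicit formula below.\<close>

definition drifted_bm ::
    "real ^ 'n \<Rightarrow> real ^ 'n \<Rightarrow> real ^ 'n \<Rightarrow> (real \<Rightarrow> 'a \<Rightarrow> real ^ 'n) \<Rightarrow> real \<Rightarrow> 'a \<Rightarrow> real ^ 'n" where
  "drifted_bm \<mu> \<sigma> x W t \<omega> = (\<chi> k. x $ k + \<mu> $ k * t + \<sigma> $ k * W t \<omega> $ k)"

definition corr :: "'a measure \<Rightarrow> ('a \<Rightarrow> real) \<Rightarrow> ('a \<Rightarrow> real) \<Rightarrow> real" where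
  "corr M Y Z =
     (\<integral>\<omega>. (Y \<omega> - (\<integral>\<omega>'. Y \<omega>' \<partial>M)) * (Z \<omega> - (\<integral>\<omega>'. Z \<omega>' \<partial>M)) \<partial>M) /
     (sqrt (\<integral>\<omega>. (Y \<omega> - (\<integral>\<omega>'. Y \<omega>' \<partial>M))\<^sup>2 \<partial>M) * sqrt (\<integral>\<omega>. (Z \<omega> - (\<integral>\<omega>'. Z \<omega>' \<partial>M))\<^sup>2 \<partial>M))"

text \<open>On a path that never reaches its level the infimum of the empty set is an unspecified real.
  When every drift is zero or points towards its level, almost every path reaches it.\<close>

definition hitting_times ::
    "(real \<Rightarrow> 'a \<Rightarrow> real ^ 'n) \<Rightarrow> real ^ 'n \<Rightarrow> 'a \<Rightarrow> real ^ 'n" where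
  "hitting_times X b \<omega> = (\<chi> k. Inf {t. 0 < t \<and> X t \<omega> $ k = b $ k})"

text \<open>Below, \<open>c\<close> is the signed distance \<open>b\<^sub>i - x\<^sub>i\<close> to the level and \<open>y\<close> is a value of \<open>\<chi>\<^sub>i\<^sup>2\<close>,
  so that \<open>sqrt y\<close> stands for \<open>|\<chi>\<^sub>i|\<close>.\<close>

definition H :: "real \<Rightarrow> real \<Rightarrow> real \<Rightarrow> real \<Rightarrow> real" where
  "H m s c t = (m * t - c)\<^sup>2 / (s\<^sup>2 * t)"

definition root1 :: "real \<Rightarrow> real \<Rightarrow> real \<Rightarrow> real \<Rightarrow> real" where
  "root1 m s c y =
     (if m = 0 then c\<^sup>2 / (s\<^sup>2 * y)
      else c / m + s\<^sup>2 * y / (2 * m\<^sup>2) - s * sqrt y / (2 * m\<^sup>2) * sqrt (4 * m * c + s\<^sup>2 * y))"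

definition root2 :: "real \<Rightarrow> real \<Rightarrow> real \<Rightarrow> real \<Rightarrow> real" where
  "root2 m s c y =
     (if m = 0 then c\<^sup>2 / (s\<^sup>2 * y) else c\<^sup>2 / (m\<^sup>2 * root1 m s c y))"

definition root_sel :: "nat \<Rightarrow> real \<Rightarrow> real \<Rightarrow> real \<Rightarrow> real \<Rightarrow> real" where
  "root_sel j = (if j = 1 then root1 else root2)"

definition multi_indices :: "('n \<Rightarrow> nat) set" where
  "multi_indices = (UNIV \<rightarrow> {1, 2})"

definition root_vec ::
    "real ^ 'n \<Rightarrow> real ^ 'n \<Rightarrow> real ^ 'n \<Rightarrow> ('n \<Rightarrow> nat) \<Rightarrow> real ^ 'n \<Rightarrow> real ^ 'n" where
  "root_vec \<mu> \<sigma> c u y = (\<chi> k. root_sel (u k) (\<mu> $ k) (\<sigma> $ k) (c $ k) (y $ k))"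

text \<open>The weights \<open>p\<^sub>u\<close> as functions of \<open>y = (\<chi>\<^sub>1\<^sup>2, \<dots>, \<chi>\<^sub>N\<^sup>2)\<close>. They are computed in
  \<^typ>\<open>ennreal\<close> because \<open>f\<close> may vanish at some of the points: there a quotient \<open>r / 0\<close> with
  \<open>r > 0\<close> is infinite, which makes \<open>p\<^sub>u = 0\<close> as intended. With real division it would be \<open>0\<close>.\<close>

definition branch_weight ::
    "real ^ 'n \<Rightarrow> real ^ 'n \<Rightarrow> real ^ 'n \<Rightarrow> (real ^ 'n \<Rightarrow> ennreal) \<Rightarrow> ('n \<Rightarrow> nat) \<Rightarrow> real ^ 'n \<Rightarrow> ennreal"
  where
  "branch_weight \<mu> \<sigma> c f u y =
     inverse (1 + (\<Sum>i \<in> multi_indices - {u}.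
       ennreal (\<Prod>k\<in>UNIV. \<bar>deriv (H (\<mu> $ k) (\<sigma> $ k) (c $ k)) (root_vec \<mu> \<sigma> c u y $ k) /
                          deriv (H (\<mu> $ k) (\<sigma> $ k) (c $ k)) (root_vec \<mu> \<sigma> c i y $ k)\<bar>) *
       (f (root_vec \<mu> \<sigma> c i y) / f (root_vec \<mu> \<sigma> c u y))))"

end

theory Submission
  imports Defs
begin

text \<open>The vector \<open>\<tau>\<close> has a density, so almost surely no coordinate equals the value of the infimum
  of the empty set; hence almost surely every level is reached and \<open>\<tau>\<close> is positive. No further
  property of Brownian motion is needed.

  With \<open>a\<^sub>k = (c\<^sub>k / \<mu>\<^sub>k)\<^sup>2\<close>, the two solutions of \<open>H\<^sub>k = y\<close> are exchanged by the involution
  \<open>t \<mapsto> a\<^sub>k / t\<close>, and since \<open>H\<^sub>k\<close> is invariant under it, the quotients of the derivatives of \<open>H\<^sub>k\<close>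
  are its Jacobians. Given the orbit of \<open>\<tau>\<close> under the group generated by these coordinate
  involutions, \<open>\<tau>\<close> sits at a point with probability proportional to the density \<open>f\<close> at that point,
  transported by the Jacobian, and this is exactly \<open>p\<^sub>u\<close>. The change of variables for the
  involutions turns this into the equality of laws.\<close>

section \<open>Coordinate flips and their Jacobians\<close>

text \<open>The case \<open>a = 0\<close> stands for the identity: \<open>a\<close> will be \<open>(c / m)\<^sup>2\<close>, which is \<open>0\<close> for \<open>m = 0\<close>, where
  \<open>H\<close> is injective. Nonpositive arguments are fixed so that \<open>flip a\<close> is a bijection of the whole line.\<close>

definition flip :: "real \<Rightarrow> real \<Rightarrow> real" where
  "flip a t = (if a = 0 \<or> t \<le> 0 then t else a / t)"

text \<open>For \<open>a \<ge> 0\<close> this is the modulus of the derivative of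
  \<open>flip a\<close>, except at \<open>t = 0 < a\<close>, where \<open>flip a\<close> is
  discontinuous; the value 1 there concerns a null set and keeps the density positive.\<close>

definition flip_density :: "real \<Rightarrow> real \<Rightarrow> real" where
  "flip_density a t = (if a = 0 \<or> t \<le> 0 then 1 else a / t\<^sup>2)"

definition flip_on :: "real ^ 'n \<Rightarrow> 'n set \<Rightarrow> real ^ 'n \<Rightarrow> real ^ 'n" where
  "flip_on a e t = (\<chi> k. if k \<in> e then flip (a $ k) (t $ k) else t $ k)"

text \<open>Off a null set the derivative of \<open>flip_on a e\<close> is diagonal, with entries of
  modulus 1 outside \<open>e\<close>; this is the modulus of its determinant.\<close>

definition flip_jacobian :: "real ^ 'n \<Rightarrow> 'n set \<Rightarrow> real ^ 'n \<Rightarrow> real" where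
  "flip_jacobian a e t = (\<Prod>k\<in>e. flip_density (a $ k) (t $ k))"

lemma flip_measurable [measurable]: "flip a \<in> borel_measurable borel"
  unfolding flip_def by measurable

lemma flip_density_measurable [measurable]: "flip_density a \<in> borel_measurable borel"
  unfolding flip_density_def by measurable

lemma vec_lambda_measurable:
  fixes f :: "'n::finite \<Rightarrow> 'a \<Rightarrow> real"
  assumes "\<And>k. f k \<in> borel_measurable M"
  shows "(\<lambda>x. \<chi> k. f k x) \<in> borel_measurable M"
  using assms
  by (subst borel_measurable_euclidean_space) (auto simp: Basis_vec_def inner_axis)

lemma vec_nth_measurable [measurable]:
  "(\<lambda>x :: real ^ 'n. x $ k) \<in> borel_measurable borel"
  by (intro borel_measurable_continuous_onI continuous_intros)

lemma flip_on_measurable [measurable]: "flip_on a e \<in> borel_measurable borel"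
  unfolding flip_on_def by (rule vec_lambda_measurable) measurable

lemma flip_jacobian_measurable [measurable]: "flip_jacobian a e \<in> borel_measurable borel"
  unfolding flip_jacobian_def by measurable

lemma flip_density_pos: "0 \<le> a \<Longrightarrow> 0 < flip_density a t"
  by (auto simp: flip_density_def)

lemma flip_flip: "0 \<le> a \<Longrightarrow> flip a (flip a t) = t"
  by (auto simp: flip_def divide_le_0_iff)

section \<open>Change of variables on the line\<close>

text \<open>The half-line is the preimage of \<open>{0<..<v}\<close> under \<open>flip a\<close>.
  The antiderivative \<open>- a / t\<close> rises from \<open>- v\<close> at its left end to 0 at
  infinity.\<close>

lemma nn_integral_inverse_square:
  fixes a v :: real
  assumes "0 < a" "0 < v"
  shows "(\<integral>\<^sup>+t. ennreal (a / t\<^sup>2) * indicator {a / v<..} t \<partial>lborel) = ennreal v"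
proof -
  have "(\<integral>\<^sup>+t. ennreal (a / t\<^sup>2) * indicator {a / v<..} t \<partial>lborel) =
        (\<integral>\<^sup>+t. ennreal (a / t\<^sup>2) * indicator {a / v..} t \<partial>lborel)"
  proof (rule nn_integral_cong_AE, use AE_lborel_singleton[of "a / v"] in eventually_elim)
    case (elim t)
    then have "indicator {a / v<..} t = (indicator {a / v..} t :: ennreal)"
      unfolding indicator_def by (simp add: less_le)
    then show "ennreal (a / t\<^sup>2) * indicator {a / v<..} t = ennreal (a / t\<^sup>2) * indicator {a / v..} t"
      by simp
  qed
  also have "\<dots> = ennreal (0 - (- a / (a / v)))"
  proof (rule nn_integral_FTC_atLeast)
    fix t assume "a / v \<le> t"
    moreover have "0 < a / v" using assms by simp
    ultimately have "0 < t" by linarith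
    then show "((\<lambda>t. - a / t) has_real_derivative a / t\<^sup>2) (at t)"
      by (auto intro!: derivative_eq_intros simp: power2_eq_square)
    show "0 \<le> a / t\<^sup>2" using assms by simp
  next
    show "((\<lambda>t. - a / t) \<longlongrightarrow> 0) at_top"
      by (rule tendsto_divide_0[OF tendsto_const]) (rule filterlim_at_top_imp_at_infinity[OF filterlim_ident])
  qed measurable
  finally show ?thesis using assms by simp
qed

text \<open>Open intervals suffice, as they are the sides of the boxes that determine Lebesgue
  measure. For \<open>a > 0\<close> the flip maps the positive half-line onto itself and fixes the
  rest, hence the cases by the position of \<open>l\<close> and \<open>u\<close> relative to
  0.\<close>

lemma nn_integral_flip_interval:
  fixes a l u :: real
  assumes "0 \<le> a" "l \<le> u"
  shows "(\<integral>\<^sup>+t. ennreal (flip_density a t) * indicator {l<..<u} (flip a t) \<partial>lborel) = ennreal (u - l)"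
proof (cases "a = 0")
  case True
  have "(\<integral>\<^sup>+t. indicator {l<..<u} t \<partial>lborel) = ennreal (u - l)" using assms by simp
  then show ?thesis using True by (simp add: flip_def flip_density_def)
next
  case False
  then have a: "0 < a" using assms by simp
  \<comment> \<open>The bounds are generalised because the case \<open>l < 0 < u\<close> needs the
    interval from 0 to \<open>u\<close>.\<close>
  have positive: "(\<integral>\<^sup>+t. ennreal (flip_density a t) * indicator {l<..<u} (flip a t) \<partial>lborel) = ennreal (u - l)"
    if "0 \<le> l" "l \<le> u" for l u
  proof (cases "l = 0 \<or> l = u")
    case True
    show ?thesis
    proof (cases "l = u")
      case False
      then have l: "l = 0" "0 < u" using True that by auto
      have "(\<integral>\<^sup>+t. ennreal (flip_density a t) * indicator {l<..<u} (flip a t) \<partial>lborel) =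
            (\<integral>\<^sup>+t. ennreal (a / t\<^sup>2) * indicator {a / u<..} t \<partial>lborel)"
      proof (rule nn_integral_cong)
        fix t
        show "ennreal (flip_density a t) * indicator {l<..<u} (flip a t) = ennreal (a / t\<^sup>2) * indicator {a / u<..} t"
        proof (cases "0 < t")
          case True
          then have "a / t < u \<longleftrightarrow> a / u < t" using l by (simp add: field_simps)
          then have "indicator {l<..<u} (flip a t) = (indicator {a / u<..} t :: ennreal)"
            using True a l by (simp add: flip_def indicator_def)
          then show ?thesis using True a by (simp add: flip_density_def)
        next
          case False
          moreover have "0 < a / u" using a l by simp
          ultimately have "\<not> a / u < t" by linarith
          then show ?thesis using False l by (simp add: flip_def indicator_def)
        qed
      qed
      then show ?thesis using nn_integral_inverse_square[OF a l(2)] l by simp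
    qed simp
  next
    case False
    then have l: "0 < l" "l < u" using that by auto
    \<comment> \<open>The flip reverses the order of positive numbers, so the preimage runs from
      \<open>a / u\<close> to \<open>a / l\<close>. Its endpoints are added, at the cost of a null
      set, to apply the fundamental theorem on a closed interval.\<close>
    have le: "a / u \<le> a / l" using a l by (simp add: frac_le)
    have "(\<integral>\<^sup>+t. ennreal (flip_density a t) * indicator {l<..<u} (flip a t) \<partial>lborel) =
          (\<integral>\<^sup>+t. ennreal (a / t\<^sup>2) * indicator {a / u..a / l} t \<partial>lborel)"
    proof (rule nn_integral_cong_AE,
        use AE_lborel_singleton[of "a / u"] AE_lborel_singleton[of "a / l"] in eventually_elim)
      case (elim t)
      show "ennreal (flip_density a t) * indicator {l<..<u} (flip a t) = ennreal (a / t\<^sup>2) * indicator {a / u..a / l} t"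
      proof (cases "0 < t")
        case True
        then have "a / t < u \<longleftrightarrow> a / u < t" "l < a / t \<longleftrightarrow> t < a / l"
          using l by (simp_all add: field_simps)
        then have "flip a t \<in> {l<..<u} \<longleftrightarrow> t \<in> {a / u..a / l}"
          using True a elim unfolding flip_def by (auto simp: less_le)
        then have "indicator {l<..<u} (flip a t) = (indicator {a / u..a / l} t :: ennreal)"
          unfolding indicator_def by simp
        then show ?thesis using True a by (simp add: flip_density_def)
      next
        case False
        moreover have "0 < a / u" using a l by simp
        ultimately have "\<not> a / u \<le> t" by linarith
        then show ?thesis using False l by (simp add: flip_def indicator_def)
      qed
    qed
    also have "\<dots> = ennreal ((- a / (a / l)) - (- a / (a / u)))"
    proof (rule nn_integral_FTC_Icc[OF _ _ _ le])
      fix t assume "t \<in> {a / u..a / l}"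
      then have "a / u \<le> t" by simp
      moreover have "0 < a / u" using a l by simp
      ultimately have "0 < t" by linarith
      then show "((\<lambda>t. - a / t) has_real_derivative a / t\<^sup>2) (at t)"
        by (auto intro!: derivative_eq_intros simp: power2_eq_square)
      show "0 \<le> a / t\<^sup>2" using a by simp
    qed measurable
    also have "(- a / (a / l)) - (- a / (a / u)) = u - l" using a l by simp
    finally show ?thesis .
  qed
  consider "0 \<le> l" | "u \<le> 0" | "l < 0" "0 < u" by linarith
  then show ?thesis
  proof cases
    case 1
    then show ?thesis using positive assms by simp
  next
    case 2
    have "(\<integral>\<^sup>+t. ennreal (flip_density a t) * indicator {l<..<u} (flip a t) \<partial>lborel) =
          (\<integral>\<^sup>+t. indicator {l<..<u} t \<partial>lborel)"
    proof (rule nn_integral_cong)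
      fix t
      show "ennreal (flip_density a t) * indicator {l<..<u} (flip a t) = indicator {l<..<u} t"
      proof (cases "0 < t")
        case True
        then have "0 < a / t" using a by simp
        then have "\<not> a / t < u" "\<not> t < u" using 2 True by linarith+
        then show ?thesis using True a by (simp add: flip_def indicator_def)
      qed (simp add: flip_def flip_density_def)
    qed
    then show ?thesis using assms by simp
  next
    \<comment> \<open>The integral splits at 0: on \<open>{l<..0}\<close> the flip is the identity
      with density 1, and the positive points account for the interval from 0 to
      \<open>u\<close>.\<close>
    case 3
    have "(\<integral>\<^sup>+t. ennreal (flip_density a t) * indicator {l<..<u} (flip a t) \<partial>lborel) =
          (\<integral>\<^sup>+t. indicator {l<..0} t +
             ennreal (flip_density a t) * indicator {0<..<u} (flip a t) \<partial>lborel)"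
    proof (rule nn_integral_cong)
      fix t
      show "ennreal (flip_density a t) * indicator {l<..<u} (flip a t) =
          indicator {l<..0} t + ennreal (flip_density a t) * indicator {0<..<u} (flip a t)"
      proof (cases "0 < t")
        case True
        then have "0 < a / t" using a by simp
        then have "l < a / t" "\<not> t \<le> 0" using 3 True by linarith+
        then show ?thesis using True a by (simp add: flip_def indicator_def)
      next
        case False
        then show ?thesis using 3 by (simp add: flip_def flip_density_def indicator_def)
      qed
    qed
    also have "\<dots> = ennreal (0 - l) + ennreal (u - 0)"
      using 3 by (subst nn_integral_add) (simp_all add: positive)
    also have "\<dots> = ennreal (u - l)" using 3 by (subst ennreal_plus[symmetric]) auto
    finally show ?thesis .
  qed
qed

section \<open>Change of variables in several dimensions\<close>

lemma prod_Basis_vec: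
  fixes g :: "real ^ 'n \<Rightarrow> 'b :: comm_monoid_mult"
  shows "(\<Prod>b\<in>Basis. g b) = (\<Prod>k\<in>UNIV. g (axis k 1))"
proof -
  have "(\<Prod>b\<in>(\<lambda>k. axis k 1 :: real ^ 'n) ` UNIV. g b) = (\<Prod>k\<in>UNIV. g (axis k 1))"
    by (rule prod.reindex_cong[OF _ refl refl]) (simp add: inj_def axis_eq_axis)
  moreover have "(\<lambda>k. axis k 1 :: real ^ 'n) ` UNIV = Basis" by (auto simp: Basis_vec_def)
  ultimately show ?thesis by metis
qed

lemma nn_integral_lborel_vec_prod:
  fixes h :: "'n::finite \<Rightarrow> real \<Rightarrow> ennreal"
  assumes "\<And>k. h k \<in> borel_measurable borel"
  shows "(\<integral>\<^sup>+x. (\<Prod>k\<in>UNIV. h k (x $ k)) \<partial>lborel) = (\<Prod>k\<in>UNIV. \<integral>\<^sup>+x. h k x \<partial>lborel)"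
  using nn_integral_lborel_prod[of "\<lambda>b :: real ^ 'n. h (axis_index b)"] assms
  by (simp add: prod_Basis_vec inner_axis)

text \<open>Boxes determine \<open>lborel\<close>, and over a box the integrand factors over the
  coordinates. Each factor \<open>h k\<close> integrates to the side length, by the change of
  variables on the line if \<open>k \<in> e\<close> and trivially otherwise.\<close>

lemma lborel_eq_distr_flip_on:
  fixes a :: "real ^ 'n"
  assumes "\<And>k. 0 \<le> a $ k"
  shows "lborel = distr (density lborel (\<lambda>t. ennreal (flip_jacobian a e t))) borel (flip_on a e)"
proof (rule lborel_eqI)
  fix l u :: "real ^ 'n"
  assume lu: "\<And>b. b \<in> Basis \<Longrightarrow> l \<bullet> b \<le> u \<bullet> b"
  have lu': "l $ k \<le> u $ k" for k using lu[of "axis k 1"] by (simp add: inner_axis)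
  define h where "h k t = (if k \<in> e then ennreal (flip_density (a $ k) t) * indicator {l $ k<..<u $ k} (flip (a $ k) t)
     else indicator {l $ k<..<u $ k} t :: ennreal)" for k t
  have [measurable]: "h k \<in> borel_measurable borel" for k unfolding h_def by measurable
  have h: "(\<integral>\<^sup>+t. h k t \<partial>lborel) = ennreal (u $ k - l $ k)" for k
    by (cases "k \<in> e") (simp_all add: h_def nn_integral_flip_interval[OF assms lu'] lu')
  have hprod: "ennreal (flip_jacobian a e t) * indicator (box l u) (flip_on a e t) = (\<Prod>k\<in>UNIV. h k (t $ k))" for t
  proof -
    have "ennreal (flip_jacobian a e t) = (\<Prod>k\<in>UNIV. if k \<in> e then ennreal (flip_density (a $ k) (t $ k)) else 1)"
      unfolding flip_jacobian_def
      by (simp add: prod_ennreal[symmetric] flip_density_pos[OF assms] less_imp_le prod.If_cases)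
    moreover have "indicator (box l u) z = (\<Prod>k\<in>UNIV. indicator {l $ k<..<u $ k} (z $ k) :: ennreal)" for z
    proof (cases "z \<in> box l u")
      case True
      then show ?thesis by (auto simp: mem_box_cart)
    next
      case False
      then obtain k where "z $ k \<notin> {l $ k<..<u $ k}" by (auto simp: mem_box_cart)
      then have "(\<Prod>k\<in>UNIV. indicator {l $ k<..<u $ k} (z $ k) :: ennreal) = 0"
        by (intro prod_zero bexI[of _ k]) auto
      then show ?thesis using False by simp
    qed
    ultimately show ?thesis
      by (simp add: h_def flip_on_def prod.distrib[symmetric] if_distrib if_distribR cong: if_cong)
  qed
  have "emeasure (distr (density lborel (\<lambda>t. ennreal (flip_jacobian a e t))) borel (flip_on a e)) (box l u)
      = (\<integral>\<^sup>+t. indicator (box l u) t \<partial>distr (density lborel (\<lambda>t. ennreal (flip_jacobian a e t))) borel (flip_on a e))"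
    by (rule nn_integral_indicator[symmetric]) simp
  also have "\<dots> = (\<integral>\<^sup>+t. ennreal (flip_jacobian a e t) * indicator (box l u) (flip_on a e t) \<partial>lborel)"
    by (subst nn_integral_distr) (simp_all add: nn_integral_density)
  also have "\<dots> = (\<Prod>k\<in>UNIV. \<integral>\<^sup>+t. h k t \<partial>lborel)"
    unfolding hprod by (rule nn_integral_lborel_vec_prod) measurable
  also have "\<dots> = (\<Prod>k\<in>UNIV. ennreal (u $ k - l $ k))"
    by (simp only: h)
  also have "\<dots> = ennreal (\<Prod>b\<in>Basis. (u - l) \<bullet> b)"
    using lu' by (simp add: prod_Basis_vec inner_axis prod_ennreal)
  finally show "emeasure (distr (density lborel (\<lambda>t. ennreal (flip_jacobian a e t))) borel (flip_on a e)) (box l u)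
      = ennreal (\<Prod>b\<in>Basis. (u - l) \<bullet> b)" .
qed simp

lemma nn_integral_flip_on:
  fixes a :: "real ^ 'n"
  assumes "\<And>k. 0 \<le> a $ k" and [measurable]: "h \<in> borel_measurable borel"
  shows "(\<integral>\<^sup>+t. h t \<partial>lborel) = (\<integral>\<^sup>+t. ennreal (flip_jacobian a e t) * h (flip_on a e t) \<partial>lborel)"
proof -
  have "(\<integral>\<^sup>+t. h t \<partial>lborel) = (\<integral>\<^sup>+t. h t \<partial>distr (density lborel (\<lambda>t. ennreal (flip_jacobian a e t))) borel (flip_on a e))"
    by (rule arg_cong[OF lborel_eq_distr_flip_on[OF assms(1)]])
  also have "\<dots> = (\<integral>\<^sup>+t. h (flip_on a e t) \<partial>density lborel (\<lambda>t. ennreal (flip_jacobian a e t)))"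
    by (rule nn_integral_distr) measurable
  also have "\<dots> = (\<integral>\<^sup>+t. ennreal (flip_jacobian a e t) * h (flip_on a e t) \<partial>lborel)"
    by (rule nn_integral_density) measurable
  finally show ?thesis .
qed

lemma flip_jacobian_pos: "(\<And>k. 0 \<le> a $ k) \<Longrightarrow> 0 < flip_jacobian a e t"
  unfolding flip_jacobian_def by (intro prod_pos ballI flip_density_pos) auto

text \<open>As the Jacobian is positive, the weighted measure that \<open>flip_on a e\<close> pushes
  forward to \<open>lborel\<close> has the same null sets as \<open>lborel\<close>; so preimages of
  null sets are null.\<close>

lemma AE_flip_on:
  fixes a :: "real ^ 'n"
  assumes "\<And>k. 0 \<le> a $ k" "Measurable.pred borel Q" "AE t in lborel. Q t"
  shows "AE t in lborel. Q (flip_on a e t)"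
proof -
  have "AE t in distr (density lborel (\<lambda>t. ennreal (flip_jacobian a e t))) borel (flip_on a e). Q t"
    using assms(3) lborel_eq_distr_flip_on[OF assms(1), of e] by metis
  then have "AE t in density lborel (\<lambda>t. ennreal (flip_jacobian a e t)). Q (flip_on a e t)"
    using assms(2) by (subst (asm) AE_distr_iff) (auto simp: pred_def)
  then show ?thesis
    using flip_jacobian_pos[OF assms(1)] by (simp add: AE_density)
qed

lemma flip_on_flip_on: "(\<And>k. 0 \<le> a $ k) \<Longrightarrow> flip_on a e (flip_on a e t) = t"
  by (simp add: flip_on_def flip_flip vec_eq_iff)

section \<open>The two solutions of \<open>H m s c t = y\<close> and the derivative of
  \<open>H\<close> there\<close>

lemma same_sign_pos:
  fixes m c :: real
  assumes "0 \<le> m / c" "c \<noteq> 0" "m \<noteq> 0"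
  shows "0 < m * c" "0 < c / m"
  using assms by (auto simp: zero_le_divide_iff zero_less_mult_iff zero_less_divide_iff)

text \<open>For \<open>t > 0\<close> the equation \<open>H m s c t = y\<close> is quadratic, and its
  roots have half-sum \<open>p\<close>, half-difference \<open>q\<close> and product
  \<open>(c / m)\<^sup>2\<close>. The discriminant is positive because \<open>m * c > 0\<close>. As
  \<open>root2\<close> is defined through Vieta's formula, it is \<open>p + q\<close>.\<close>

lemma root_quadratic:
  fixes m s c y :: real
  assumes "0 \<le> m / c" "c \<noteq> 0" "0 < s" "0 < y" "m \<noteq> 0"
  defines "q \<equiv> s * sqrt y / (2 * m\<^sup>2) * sqrt (4 * m * c + s\<^sup>2 * y)"
    and "p \<equiv> c / m + s\<^sup>2 * y / (2 * m\<^sup>2)"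
  shows "root1 m s c y = p - q" "root2 m s c y = p + q" "0 < q" "0 < p - q" "(p - q) * (p + q) = (c / m)\<^sup>2"
proof -
  have mc: "0 < m * c" "0 < c / m" using same_sign_pos assms by blast+
  have D: "0 < 4 * m * c + s\<^sup>2 * y" using mc assms by (simp add: add_pos_pos mult.assoc)
  show r1: "root1 m s c y = p - q" using assms(5) by (simp add: root1_def p_def q_def)
  show q: "0 < q" unfolding q_def using assms D by simp
  have p: "0 < p" unfolding p_def using assms mc by (simp add: add_pos_pos)
  have "q\<^sup>2 = s\<^sup>2 * y * (4 * m * c + s\<^sup>2 * y) / (2 * m\<^sup>2)\<^sup>2"
    unfolding q_def using assms D by (simp add: power_mult_distrib power_divide)
  then show pq: "(p - q) * (p + q) = (c / m)\<^sup>2"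
    using assms(5) unfolding p_def by (simp add: field_simps power2_eq_square)
  have "0 < (c / m)\<^sup>2" using assms by simp
  then show pos: "0 < p - q" using pq p q by (metis add_pos_pos zero_less_mult_pos2)
  show "root2 m s c y = p + q"
    using assms(5) pq pos unfolding root2_def r1 by (simp add: field_simps)
qed

lemma roots_order:
  fixes m s c y :: real
  assumes "0 \<le> m / c" "c \<noteq> 0" "0 < s" "0 < y" "m \<noteq> 0"
  shows "0 < root1 m s c y" "root1 m s c y < root2 m s c y"
    and "root1 m s c y * root2 m s c y = (c / m)\<^sup>2"
  using root_quadratic[OF assms] by simp_all

lemma root_pos:
  assumes "0 \<le> m / c" "c \<noteq> 0" "0 < s" "0 < y"
  shows "0 < root_sel j m s c y"
proof (cases "m = 0")
  case True
  then show ?thesis using assms by (simp add: root_sel_def root1_def root2_def)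
next
  case False
  then show ?thesis using roots_order[OF assms False] by (simp add: root_sel_def)
qed

text \<open>On the positive half-line \<open>c / m\<close> is the minimum point of \<open>H\<close>,
  the zero of its derivative and the fixed point of the flip. It is the geometric mean of the two
  distinct roots, hence strictly between them.\<close>

lemma root_ne_vertex:
  assumes "0 \<le> m / c" "c \<noteq> 0" "0 < s" "0 < y" "m \<noteq> 0"
  shows "m\<^sup>2 * (root_sel j m s c y)\<^sup>2 \<noteq> c\<^sup>2"
proof
  assume "m\<^sup>2 * (root_sel j m s c y)\<^sup>2 = c\<^sup>2"
  then have "(root_sel j m s c y)\<^sup>2 = (c / m)\<^sup>2" using assms(5) by (simp add: field_simps)
  moreover have "(root1 m s c y)\<^sup>2 < (c / m)\<^sup>2" "(c / m)\<^sup>2 < (root2 m s c y)\<^sup>2"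
    unfolding roots_order(3)[OF assms, symmetric] using roots_order(1,2)[OF assms]
    by (simp_all add: power2_eq_square)
  ultimately show False by (auto simp: root_sel_def split: if_splits)
qed

text \<open>For \<open>m \<noteq> 0\<close> this is Vieta's formula for the product. For
  \<open>m = 0\<close> the roots coincide, and \<open>c / 0 = 0\<close> makes the flip the
  identity.\<close>

lemma root_swap:
  assumes "0 \<le> m / c" "c \<noteq> 0" "0 < s" "0 < y" "i \<in> {1, 2}" "j \<in> {1, 2}" "i \<noteq> j"
  shows "root_sel i m s c y = flip ((c / m)\<^sup>2) (root_sel j m s c y)"
proof (cases "m = 0")
  case True
  then show ?thesis using assms by (simp add: root_sel_def root1_def root2_def flip_def)
next
  case False
  note r = roots_order[OF assms(1-4) False]
  have pos: "0 < root2 m s c y" using r(1,2) by linarith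
  have "root1 m s c y = (c / m)\<^sup>2 / root2 m s c y" "root2 m s c y = (c / m)\<^sup>2 / root1 m s c y"
    using r pos by (simp_all add: nonzero_eq_divide_eq mult.commute)
  then show ?thesis using r pos assms False by (auto simp: root_sel_def flip_def)
qed

text \<open>For \<open>m \<noteq> 0\<close> the monic quadratic factors into
  \<open>t - root1 m s c y\<close> and \<open>t - root2 m s c y\<close>, so its vanishing forces one
  of the two equalities; for \<open>m = 0\<close> the equation is linear in \<open>t\<close>.
  Excluding \<open>m * t = c\<close> keeps \<open>y\<close> positive.\<close>

lemma root_of_H:
  assumes "0 \<le> m / c" "c \<noteq> 0" "0 < s" "0 < t" "m * t \<noteq> c"
  shows "0 < H m s c t" "\<exists>j\<in>{1, 2}. t = root_sel j m s c (H m s c t)"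
proof -
  show y: "0 < H m s c t" using assms by (simp add: H_def)
  define y where "y = H m s c t"
  have eq: "(m * t - c)\<^sup>2 = s\<^sup>2 * y * t" using assms by (simp add: H_def y_def)
  show "\<exists>j\<in>{1, 2}. t = root_sel j m s c (H m s c t)"
  proof (cases "m = 0")
    case True
    then have "t = c\<^sup>2 / (s\<^sup>2 * y)" using eq y assms by (simp add: field_simps y_def)
    then show ?thesis using True by (simp add: root_sel_def root1_def y_def)
  next
    case False
    note r = root_quadratic[OF assms(1-3) y False, folded y_def]
    have "(t - root1 m s c y) * (t - root2 m s c y) = t\<^sup>2 - 2 * (c / m + s\<^sup>2 * y / (2 * m\<^sup>2)) * t + (c / m)\<^sup>2"
      unfolding r(1,2) r(5)[symmetric] by (simp add: algebra_simps power2_eq_square)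
    also have "\<dots> = ((m * t - c)\<^sup>2 - s\<^sup>2 * y * t) / m\<^sup>2"
      using False by (simp add: field_simps power2_eq_square)
    finally have "t = root1 m s c y \<or> t = root2 m s c y" using eq by simp
    then show ?thesis by (auto simp: root_sel_def y_def)
  qed
qed

lemma deriv_H:
  assumes "0 < s" "0 < t"
  shows "deriv (H m s c) t = (m\<^sup>2 * t\<^sup>2 - c\<^sup>2) / (s\<^sup>2 * t\<^sup>2)"
proof (rule DERIV_imp_deriv)
  show "(H m s c has_real_derivative (m\<^sup>2 * t\<^sup>2 - c\<^sup>2) / (s\<^sup>2 * t\<^sup>2)) (at t)"
    unfolding H_def[abs_def] using assms
    by (auto intro!: derivative_eq_intros simp: field_simps power2_eq_square)
qed

text \<open>\<open>H\<close> is invariant under the flip, so by the chain rule the quotient of its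
  derivatives is the derivative of the flip; the proof checks this on the explicit formula. For
  \<open>m = 0\<close> both indices select the same root and both sides are 1.\<close>

lemma deriv_H_ratio_swap:
  assumes "0 \<le> m / c" "c \<noteq> 0" "0 < s" "0 < y" "i \<in> {1, 2}" "j \<in> {1, 2}" "i \<noteq> j"
  shows "\<bar>deriv (H m s c) (root_sel j m s c y) / deriv (H m s c) (root_sel i m s c y)\<bar> =
    flip_density ((c / m)\<^sup>2) (root_sel j m s c y)"
proof (cases "m = 0")
  case True
  then have "root_sel i m s c y = root_sel j m s c y"
    by (simp add: root_sel_def root1_def root2_def)
  then show ?thesis
    using True assms root_pos[OF assms(1-4), of j] by (simp add: deriv_H flip_density_def)
next
  case False
  define t where "t = root_sel j m s c y"
  have t: "0 < t" unfolding t_def using root_pos[OF assms(1-4)] .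
  have ne: "m\<^sup>2 * t\<^sup>2 - c\<^sup>2 \<noteq> 0"
    using root_ne_vertex[OF assms(1-4) False, of j] by (simp add: t_def)
  have i: "root_sel i m s c y = (c / m)\<^sup>2 / t"
    unfolding root_swap[OF assms] using t assms(2) False unfolding t_def[symmetric] by (simp add: flip_def)
  have "deriv (H m s c) ((c / m)\<^sup>2 / t) = - (m\<^sup>2 * t\<^sup>2 - c\<^sup>2) * m\<^sup>2 / (s\<^sup>2 * c\<^sup>2)"
  proof (subst deriv_H)
    show "0 < (c / m)\<^sup>2 / t" using t assms(2) False by simp
    show "(m\<^sup>2 * ((c / m)\<^sup>2 / t)\<^sup>2 - c\<^sup>2) / (s\<^sup>2 * ((c / m)\<^sup>2 / t)\<^sup>2) = - (m\<^sup>2 * t\<^sup>2 - c\<^sup>2) * m\<^sup>2 / (s\<^sup>2 * c\<^sup>2)"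
      using t assms(2,3) False by (simp add: field_simps power2_eq_square)
  qed (rule assms(3))
  \<comment> \<open>\<open>d\<close> stands for \<open>m\<^sup>2 * t\<^sup>2 - c\<^sup>2\<close>, so
    that it cancels as a single nonzero symbol.\<close>
  moreover have "d / (s\<^sup>2 * t\<^sup>2) / (- d * m\<^sup>2 / (s\<^sup>2 * c\<^sup>2)) = - ((c / m)\<^sup>2 / t\<^sup>2)" if "d \<noteq> 0" for d
    using that t assms(2,3) False by (simp add: field_simps power2_eq_square)
  ultimately have "deriv (H m s c) t / deriv (H m s c) ((c / m)\<^sup>2 / t) = - ((c / m)\<^sup>2 / t\<^sup>2)"
    using ne by (simp only: deriv_H[OF assms(3) t])
  then show ?thesis
    using t assms False unfolding i t_def[symmetric] by (simp add: flip_density_def)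
qed

section \<open>Root vectors as orbits, branch weights as orbit weights\<close>

text \<open>An index vector is encoded by the set \<open>e\<close> of places where it differs from
  \<open>u\<close>, since \<open>3 - u k\<close> exchanges 1 and 2. The empty set encodes
  \<open>u\<close> itself.\<close>

lemma sum_multi_indices:
  fixes u :: "'n::finite \<Rightarrow> nat" and g :: "('n \<Rightarrow> nat) \<Rightarrow> 'a :: comm_monoid_add"
  assumes u: "u \<in> multi_indices"
  shows "(\<Sum>i\<in>multi_indices. g i) = (\<Sum>e\<in>UNIV. g (\<lambda>k. if k \<in> e then 3 - u k else u k))"
    and "(\<Sum>i\<in>multi_indices - {u}. g i) = (\<Sum>e\<in>UNIV - {{}}. g (\<lambda>k. if k \<in> e then 3 - u k else u k))"
proof -
  have u12: "u k = 1 \<or> u k = 2" for k using u by (auto simp: multi_indices_def Pi_iff)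
  have i12: "i k = 1 \<or> i k = 2" if "i \<in> multi_indices" for k and i :: "'n \<Rightarrow> nat"
    using that by (auto simp: multi_indices_def Pi_iff)
  let ?F = "\<lambda>e k. if k \<in> e then 3 - u k else u k"
  have inv: "{k. ?F e k \<noteq> u k} = e" for e
  proof -
    have "3 - u k \<noteq> u k" for k using u12[of k] by auto
    then show ?thesis by auto
  qed
  have inv': "?F {k. i k \<noteq> u k} = i" if "i \<in> multi_indices" for i
  proof
    fix k show "?F {k. i k \<noteq> u k} k = i k" using u12[of k] i12[OF that, of k] by auto
  qed
  have mem: "?F e \<in> multi_indices" for e
    unfolding multi_indices_def
  proof
    fix k show "?F e k \<in> {1, 2}" using u12[of k] by auto
  qed
  show "(\<Sum>i\<in>multi_indices. g i) = (\<Sum>e\<in>UNIV. g (?F e))"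
    by (rule sum.reindex_bij_witness[of _ ?F "\<lambda>i. {k. i k \<noteq> u k}"])
      (use inv inv' mem in auto)
  show "(\<Sum>i\<in>multi_indices - {u}. g i) = (\<Sum>e\<in>UNIV - {{}}. g (?F e))"
  proof (rule sum.reindex_bij_witness[of _ ?F "\<lambda>i. {k. i k \<noteq> u k}"])
    fix e :: "'n set" assume "e \<in> UNIV - {{}}"
    moreover have "{k. ?F e k \<noteq> u k} = {}" if "?F e = u" using fun_cong[OF that] by simp
    ultimately have "?F e \<noteq> u" using inv[of e] by blast
    then show "?F e \<in> multi_indices - {u}" using mem by simp
  qed (use inv inv' in auto)
qed

text \<open>The conditional probability that \<open>\<tau> = s\<close>, given that \<open>\<tau>\<close> lies in the orbit of \<open>s\<close>
  under the flips, divided by the number of sets of coordinates whose flip fixes \<open>s\<close>.\<close>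

definition orbit_weight :: "real ^ 'n \<Rightarrow> (real ^ 'n \<Rightarrow> ennreal) \<Rightarrow> real ^ 'n \<Rightarrow> ennreal" where
  "orbit_weight a f s =
     inverse (1 + (\<Sum>e\<in>UNIV - {{}}. ennreal (flip_jacobian a e s) * (f (flip_on a e s) / f s)))"

lemma root_vec_flip_on:
  fixes \<mu> \<sigma> c y :: "real ^ 'n"
  assumes "\<And>k. 0 \<le> \<mu> $ k / c $ k" "\<And>k. c $ k \<noteq> 0" "\<And>k. 0 < \<sigma> $ k" "\<And>k. 0 < y $ k"
    and u: "u \<in> multi_indices"
  shows "root_vec \<mu> \<sigma> c (\<lambda>k. if k \<in> e then 3 - u k else u k) y =
    flip_on (\<chi> k. (c $ k / \<mu> $ k)\<^sup>2) e (root_vec \<mu> \<sigma> c u y)"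
proof -
  have "root_sel (3 - u k) (\<mu> $ k) (\<sigma> $ k) (c $ k) (y $ k) =
      flip ((c $ k / \<mu> $ k)\<^sup>2) (root_sel (u k) (\<mu> $ k) (\<sigma> $ k) (c $ k) (y $ k))" for k
  proof -
    have "u k \<in> {1, 2}" using u by (auto simp: multi_indices_def Pi_iff)
    then show ?thesis by (intro root_swap assms) auto
  qed
  then show ?thesis by (simp add: root_vec_def flip_on_def vec_eq_iff)
qed

text \<open>The index vectors other than \<open>u\<close> become the nonempty sets \<open>e\<close>
  of flipped coordinates, and the derivative quotients multiply to the Jacobian. So the weight
  depends on \<open>u\<close> and \<open>y\<close> only through the root vector.\<close>

lemma branch_weight_eq_orbit_weight:
  fixes \<mu> \<sigma> c y :: "real ^ 'n"
  assumes "\<And>k. 0 \<le> \<mu> $ k / c $ k" "\<And>k. c $ k \<noteq> 0" "\<And>k. 0 < \<sigma> $ k" "\<And>k. 0 < y $ k"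
    and u: "u \<in> multi_indices"
  shows "branch_weight \<mu> \<sigma> c f u y = orbit_weight (\<chi> k. (c $ k / \<mu> $ k)\<^sup>2) f (root_vec \<mu> \<sigma> c u y)"
proof -
  let ?a = "\<chi> k. (c $ k / \<mu> $ k)\<^sup>2" and ?s = "root_vec \<mu> \<sigma> c u y"
  have jac: "(\<Prod>k\<in>UNIV. \<bar>deriv (H (\<mu> $ k) (\<sigma> $ k) (c $ k)) (?s $ k) /
        deriv (H (\<mu> $ k) (\<sigma> $ k) (c $ k)) (root_vec \<mu> \<sigma> c (\<lambda>k. if k \<in> e then 3 - u k else u k) y $ k)\<bar>)
      = flip_jacobian ?a e ?s" (is "(\<Prod>k\<in>UNIV. ?r k) = _") for e
  proof -
    have "?r k = (if k \<in> e then flip_density (?a $ k) (?s $ k) else 1)" for k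
    proof (cases "k \<in> e")
      case True
      have "u k \<in> {1, 2}" using u by (auto simp: multi_indices_def Pi_iff)
      then have "\<bar>deriv (H (\<mu> $ k) (\<sigma> $ k) (c $ k)) (root_sel (u k) (\<mu> $ k) (\<sigma> $ k) (c $ k) (y $ k)) /
          deriv (H (\<mu> $ k) (\<sigma> $ k) (c $ k)) (root_sel (3 - u k) (\<mu> $ k) (\<sigma> $ k) (c $ k) (y $ k))\<bar> =
        flip_density ((c $ k / \<mu> $ k)\<^sup>2) (root_sel (u k) (\<mu> $ k) (\<sigma> $ k) (c $ k) (y $ k))"
        by (intro deriv_H_ratio_swap assms) auto
      then show ?thesis using True by (simp add: root_vec_def)
    next
      case False
      define t where "t = root_sel (u k) (\<mu> $ k) (\<sigma> $ k) (c $ k) (y $ k)"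
      have "0 < t" unfolding t_def by (intro root_pos assms)
      moreover have "\<mu> $ k \<noteq> 0 \<Longrightarrow> (\<mu> $ k)\<^sup>2 * t\<^sup>2 \<noteq> (c $ k)\<^sup>2"
        unfolding t_def by (intro root_ne_vertex assms)
      \<comment> \<open>An unflipped coordinate contributes the derivative divided by itself. This
        is 1 only because the derivative is nonzero, as \<open>0 / 0 = 0\<close>.\<close>
      ultimately have "deriv (H (\<mu> $ k) (\<sigma> $ k) (c $ k)) t \<noteq> 0"
        using assms(2)[of k] assms(3)[of k] by (cases "\<mu> $ k = 0") (auto simp: deriv_H)
      then show ?thesis using False by (simp add: root_vec_def t_def)
    qed
    then show ?thesis by (simp add: flip_jacobian_def prod.If_cases)
  qed
  show ?thesis
    unfolding branch_weight_def sum_multi_indices(2)[OF u] jac orbit_weight_def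
    using root_vec_flip_on[OF assms] by simp
qed

text \<open>\<open>t\<close> is itself the root vector of some \<open>u\<close>, and relative to
  this \<open>u\<close> the index vectors enumerate the flips of \<open>t\<close>. Sums rather than
  sets are compared because points repeat where \<open>\<mu> $ k = 0\<close>.\<close>

lemma sum_root_vec_H:
  fixes \<mu> \<sigma> c t :: "real ^ 'n" and g :: "real ^ 'n \<Rightarrow> 'a :: comm_monoid_add"
  assumes "\<And>k. 0 \<le> \<mu> $ k / c $ k" "\<And>k. c $ k \<noteq> 0" "\<And>k. 0 < \<sigma> $ k"
    and t: "\<And>k. 0 < t $ k" "\<And>k. \<mu> $ k * t $ k \<noteq> c $ k"
  shows "(\<Sum>u\<in>multi_indices. g (root_vec \<mu> \<sigma> c u (\<chi> k. H (\<mu> $ k) (\<sigma> $ k) (c $ k) (t $ k)))) =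
    (\<Sum>e\<in>UNIV. g (flip_on (\<chi> k. (c $ k / \<mu> $ k)\<^sup>2) e t))"
proof -
  let ?y = "\<chi> k. H (\<mu> $ k) (\<sigma> $ k) (c $ k) (t $ k)"
  have y: "0 < ?y $ k" for k using root_of_H(1)[OF assms(1-3) t] by simp
  have "\<forall>k. \<exists>j\<in>{1, 2}. t $ k = root_sel j (\<mu> $ k) (\<sigma> $ k) (c $ k) (?y $ k)"
    using root_of_H(2)[OF assms(1-3) t] by simp
  then obtain u where u: "\<And>k. u k \<in> {1, 2}" "\<And>k. t $ k = root_sel (u k) (\<mu> $ k) (\<sigma> $ k) (c $ k) (?y $ k)"
    by metis
  have um: "u \<in> multi_indices" using u(1) by (auto simp: multi_indices_def)
  have "root_vec \<mu> \<sigma> c u ?y = t" using u(2) by (simp add: root_vec_def vec_eq_iff)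
  then show ?thesis
    unfolding sum_multi_indices(1)[OF um] using root_vec_flip_on[OF assms(1-3) y um] by simp
qed

text \<open>With \<open>R\<close> the sum over the nonempty \<open>e\<close>, the whole sum is
  \<open>f s + R\<close>, and for \<open>f s > 0\<close> the weight is
  \<open>f s / (f s + R)\<close>. Finiteness excludes \<open>R = \<infinity>\<close>, for which the
  weight would be 0.\<close>

lemma orbit_weight_sum:
  fixes a :: "real ^ 'n"
  assumes a: "\<And>k. 0 \<le> a $ k" and fin: "\<And>e. f (flip_on a e s) < \<infinity>"
  shows "(\<Sum>e\<in>UNIV. ennreal (flip_jacobian a e s) * f (flip_on a e s)) * orbit_weight a f s = f s"
proof -
  have id: "flip_on a {} s = s" by (simp add: flip_on_def vec_eq_iff)
  define F where "F e = ennreal (flip_jacobian a e s) * f (flip_on a e s)" for e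
  have F0: "F {} = f s" by (simp add: F_def id flip_jacobian_def)
  have Ffin: "F e < \<infinity>" for e using fin[of e] by (simp add: F_def ennreal_mult_less_top)
  define R where "R = (\<Sum>e\<in>UNIV - {{}}. F e)"
  have Rfin: "R < \<infinity>" using Ffin unfolding R_def by simp
  have sum: "(\<Sum>e\<in>UNIV. F e) = f s + R"
    unfolding R_def F0[symmetric] by (rule sum.remove) auto
  have "ennreal (flip_jacobian a e s) * (f (flip_on a e s) / f s) = F e * inverse (f s)" for e
    by (simp add: F_def divide_ennreal_def mult.assoc)
  then have w: "orbit_weight a f s = inverse (1 + R * inverse (f s))"
    by (simp add: orbit_weight_def R_def sum_distrib_right)
  have "(f s + R) * inverse (1 + R * inverse (f s)) = f s"
  proof (cases "f s = 0")
    \<comment> \<open>Here \<open>inverse (f s) = \<infinity>\<close>: for \<open>R > 0\<close> the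
      weight is 0, and for \<open>R = 0\<close> the sum is 0.\<close>
    case True
    then show ?thesis
      by (cases "R = 0") (auto simp: ennreal_mult_top)
  next
    case False
    then obtain x where x: "f s = ennreal x" "0 < x"
      using Ffin[of "{}"] unfolding F0 by (cases "f s") (auto simp: less_top)
    obtain r where r: "R = ennreal r" "0 \<le> r" using Rfin by (cases R) auto
    have "x + r > 0" "1 + r * inverse x > 0" using x r by (auto intro: add_pos_nonneg)
    then show ?thesis
      unfolding x(1) r(1) using x(2) r(2)
      by (simp add: inverse_ennreal ennreal_mult[symmetric] ennreal_plus[symmetric] ennreal_1[symmetric] 
           del: ennreal_plus ennreal_1) (simp add: field_simps)
  qed
  then show ?thesis unfolding w sum[symmetric] F_def .
qed

section \<open>Null hyperplanes, finiteness and measurability\<close>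

lemma AE_lborel_vec_nth_neq: "AE t in lborel. (t :: real ^ 'n) $ k \<noteq> v"
proof -
  have "{t :: real ^ 'n. t $ k = v} = {t. t \<bullet> axis k 1 = v}" by (simp add: inner_axis)
  then have "negligible {t :: real ^ 'n. t $ k = v}"
    using negligible_standard_hyperplane[of "axis k 1 :: real ^ 'n" v] by (auto simp: Basis_vec_def)
  then have "{t :: real ^ 'n. t $ k = v} \<in> null_sets lebesgue"
    by (simp add: negligible_iff_null_sets)
  moreover have "{t :: real ^ 'n. t $ k = v} \<in> sets lborel" by measurable
  ultimately have "{t :: real ^ 'n. t $ k = v} \<in> null_sets lborel"
    by (simp add: null_sets_completion_iff)
  then show ?thesis by (intro AE_I'[of "{t. t $ k = v}"]) auto
qed

lemma finite_multi_indices: "finite (multi_indices :: ('n::finite \<Rightarrow> nat) set)"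
proof -
  have "multi_indices = (UNIV :: 'n set) \<rightarrow>\<^sub>E {1, 2 :: nat}"
    by (auto simp: multi_indices_def PiE_UNIV_domain)
  moreover have "finite ((UNIV :: 'n set) \<rightarrow>\<^sub>E {1, 2 :: nat})" by (rule finite_PiE) simp_all
  ultimately show ?thesis by metis
qed

lemma root_sel_measurable [measurable]: "root_sel j m s c \<in> borel_measurable borel"
proof -
  have [measurable]: "root1 m s c \<in> borel_measurable borel"
    unfolding root1_def[abs_def] by measurable
  moreover have "root2 m s c \<in> borel_measurable borel"
    unfolding root2_def[abs_def] by measurable
  ultimately show ?thesis by (simp add: root_sel_def)
qed

lemma root_vec_measurable [measurable]: "root_vec \<mu> \<sigma> c u \<in> borel_measurable borel"
  unfolding root_vec_def[abs_def] by (rule vec_lambda_measurable) measurable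

lemma orbit_weight_measurable [measurable]:
  assumes [measurable]: "f \<in> borel_measurable borel"
  shows "orbit_weight a f \<in> borel_measurable borel"
  unfolding orbit_weight_def[abs_def] by measurable

section \<open>Integrating out the uniform variable\<close>

text \<open>By independence the joint law of \<open>Y\<close> and \<open>U\<close> is a product, so
  Tonelli's theorem integrates out \<open>U\<close> for fixed \<open>Y\<close>. The probability of
  hitting \<open>J (Y \<omega>)\<close> is its length because it lies in the unit interval.\<close>

lemma (in prob_space) nn_integral_indep_uniform:
  fixes Y :: "'a \<Rightarrow> 'b :: topological_space" and U :: "'a \<Rightarrow> real"
  assumes Y [measurable]: "Y \<in> borel_measurable M" and U [measurable]: "U \<in> borel_measurable M"
    and uniform: "distr M lborel U = uniform_measure lborel {0<..<1}"
    and indep: "indep_set {Y -` A \<inter> space M | A. A \<in> sets borel} {U -` B \<inter> space M | B. B \<in> sets borel}"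
    and J: "{(y, s). s \<in> J y} \<in> sets (borel \<Otimes>\<^sub>M borel)"
    and sub: "\<And>\<omega>. \<omega> \<in> space M \<Longrightarrow> J (Y \<omega>) \<subseteq> {0..1}"
    and h [measurable]: "h \<in> borel_measurable borel"
  shows "(\<integral>\<^sup>+\<omega>. indicator (J (Y \<omega>)) (U \<omega>) * h (Y \<omega>) \<partial>M) = (\<integral>\<^sup>+\<omega>. emeasure lborel (J (Y \<omega>)) * h (Y \<omega>) \<partial>M)"
proof -
  define K where "K = {(y, s). s \<in> J y}"
  have [measurable]: "K \<in> sets (borel \<Otimes>\<^sub>M borel)" using J by (simp add: K_def)
  interpret DY: prob_space "distr M borel Y" by (rule prob_space_distr) measurable
  interpret DU: prob_space "distr M borel U" by (rule prob_space_distr) measurable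
  have joint: "distr M borel Y \<Otimes>\<^sub>M distr M borel U = distr M (borel \<Otimes>\<^sub>M borel) (\<lambda>\<omega>. (Y \<omega>, U \<omega>))"
  proof (rule pair_measure_eqI)
    fix A B assume "A \<in> sets (distr M borel Y)" "B \<in> sets (distr M borel U)"
    then have [measurable]: "A \<in> sets borel" "B \<in> sets borel" by simp_all
    have "prob ((Y -` A \<inter> space M) \<inter> (U -` B \<inter> space M)) = prob (Y -` A \<inter> space M) * prob (U -` B \<inter> space M)"
      by (rule indep_setD[OF indep]) auto
    moreover have "(\<lambda>\<omega>. (Y \<omega>, U \<omega>)) -` (A \<times> B) \<inter> space M = (Y -` A \<inter> space M) \<inter> (U -` B \<inter> space M)"
      by auto
    ultimately show "emeasure (distr M borel Y) A * emeasure (distr M borel U) B =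
        emeasure (distr M (borel \<Otimes>\<^sub>M borel) (\<lambda>\<omega>. (Y \<omega>, U \<omega>))) (A \<times> B)"
      by (simp add: emeasure_distr emeasure_eq_measure ennreal_mult)
  qed (simp_all add: DY.sigma_finite_measure_axioms DU.sigma_finite_measure_axioms cong: sets_pair_measure_cong)
  have distr_U: "distr M borel U = uniform_measure lborel {0<..<1}"
    unfolding uniform[symmetric] by (rule distr_cong) simp_all
  have inner: "emeasure (distr M borel U) (J (Y \<omega>)) = emeasure lborel (J (Y \<omega>))" if "\<omega> \<in> space M" for \<omega>
  proof -
    have "Pair (Y \<omega>) -` K \<in> sets borel" by measurable
    then have [measurable]: "J (Y \<omega>) \<in> sets borel" by (simp add: K_def vimage_def)
    \<comment> \<open>The uniform law lives on the open interval, while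
      \<open>J (Y \<omega>)\<close> may contain the endpoints; these are null.\<close>
    have "emeasure lborel ({0<..<1} \<inter> J (Y \<omega>)) = emeasure lborel (J (Y \<omega>))"
    proof (rule emeasure_eq_AE)
      show "AE s in lborel. s \<in> {0<..<1} \<inter> J (Y \<omega>) \<longleftrightarrow> s \<in> J (Y \<omega>)"
        using AE_lborel_singleton[of "0::real"] AE_lborel_singleton[of "1::real"]
      proof eventually_elim
        case (elim s)
        then show ?case using sub[OF that] by (auto simp: less_le)
      qed
    qed simp_all
    then show ?thesis by (simp add: distr_U divide_ennreal_def)
  qed
  have "(\<integral>\<^sup>+\<omega>. indicator (J (Y \<omega>)) (U \<omega>) * h (Y \<omega>) \<partial>M)
      = (\<integral>\<^sup>+\<omega>. (\<lambda>z. indicator K z * h (fst z)) (Y \<omega>, U \<omega>) \<partial>M)"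
    by (simp add: K_def indicator_def)
  also have "\<dots> = (\<integral>\<^sup>+z. indicator K z * h (fst z) \<partial>distr M (borel \<Otimes>\<^sub>M borel) (\<lambda>\<omega>. (Y \<omega>, U \<omega>)))"
    by (rule nn_integral_distr[symmetric]) measurable
  also have "\<dots> = (\<integral>\<^sup>+y. \<integral>\<^sup>+s. indicator K (y, s) * h y \<partial>distr M borel U \<partial>distr M borel Y)"
    unfolding joint[symmetric] by (subst DU.nn_integral_fst[symmetric]) simp_all
  also have "\<dots> = (\<integral>\<^sup>+\<omega>. \<integral>\<^sup>+s. indicator K (Y \<omega>, s) * h (Y \<omega>) \<partial>distr M borel U \<partial>M)"
    by (rule nn_integral_distr) simp_all
  also have "\<dots> = (\<integral>\<^sup>+\<omega>. emeasure lborel (J (Y \<omega>)) * h (Y \<omega>) \<partial>M)"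
  proof (rule nn_integral_cong)
    fix \<omega> assume \<omega>: "\<omega> \<in> space M"
    have "Pair (Y \<omega>) -` K \<in> sets borel" by measurable
    then have [measurable]: "J (Y \<omega>) \<in> sets borel" by (simp add: K_def vimage_def)
    have "(\<integral>\<^sup>+s. indicator K (Y \<omega>, s) * h (Y \<omega>) \<partial>distr M borel U)
        = (\<integral>\<^sup>+s. indicator (J (Y \<omega>)) s * h (Y \<omega>) \<partial>distr M borel U)"
      by (simp add: K_def indicator_def)
    also have "\<dots> = emeasure (distr M borel U) (J (Y \<omega>)) * h (Y \<omega>)"
      by (rule nn_integral_multc[THEN trans]) simp_all
    finally show "(\<integral>\<^sup>+s. indicator K (Y \<omega>, s) * h (Y \<omega>) \<partial>distr M borel U) = emeasure lborel (J (Y \<omega>)) * h (Y \<omega>)"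
      by (simp add: inner[OF \<omega>])
  qed
  finally show ?thesis .
qed

section \<open>Averaging over the orbits\<close>

text \<open>In the summand of \<open>e\<close>, substituting \<open>flip_on a e t\<close> for
  \<open>t\<close> brings the weight and \<open>g\<close> back to \<open>t\<close>, because the flip
  is an involution, and transports \<open>f\<close> with its Jacobian. By
  \<open>orbit_weight_sum\<close> the total factor of \<open>g t\<close> is then
  \<open>f t\<close>.\<close>

lemma nn_integral_orbit_weight:
  fixes a :: "real ^ 'n"
  assumes a: "\<And>k. 0 \<le> a $ k" and [measurable]: "f \<in> borel_measurable borel" "g \<in> borel_measurable borel"
    and fin: "(\<integral>\<^sup>+t. f t \<partial>lborel) \<noteq> \<infinity>"
  shows "(\<integral>\<^sup>+t. f t * (\<Sum>e\<in>UNIV. orbit_weight a f (flip_on a e t) * g (flip_on a e t)) \<partial>lborel) = (\<integral>\<^sup>+t. f t * g t \<partial>lborel)"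
proof -
  \<comment> \<open>A density of finite mass is finite almost everywhere, and so are its finitely
    many flipped copies; \<open>orbit_weight_sum\<close> needs all of them finite.\<close>
  have "AE t in lborel. f t < \<infinity>"
    using nn_integral_PInf_AE[OF _ fin] by (simp add: less_top)
  then have "AE t in lborel. f (flip_on a e t) < \<infinity>" for e
    by (intro AE_flip_on[OF a, of "\<lambda>t. f t < \<infinity>"]) measurable
  then have AE_fin: "AE t in lborel. \<forall>e. f (flip_on a e t) < \<infinity>" by (simp add: AE_all_countable)
  have "(\<integral>\<^sup>+t. f t * (\<Sum>e\<in>UNIV. orbit_weight a f (flip_on a e t) * g (flip_on a e t)) \<partial>lborel)
      = (\<Sum>e\<in>UNIV. \<integral>\<^sup>+t. f t * (orbit_weight a f (flip_on a e t) * g (flip_on a e t)) \<partial>lborel)"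
    unfolding sum_distrib_left by (rule nn_integral_sum) measurable
  also have "\<dots> = (\<Sum>e\<in>UNIV. \<integral>\<^sup>+t. ennreal (flip_jacobian a e t) * (f (flip_on a e t) * (orbit_weight a f t * g t)) \<partial>lborel)"
  proof (rule sum.cong[OF refl])
    fix e
    show "(\<integral>\<^sup>+t. f t * (orbit_weight a f (flip_on a e t) * g (flip_on a e t)) \<partial>lborel) =
        (\<integral>\<^sup>+t. ennreal (flip_jacobian a e t) * (f (flip_on a e t) * (orbit_weight a f t * g t)) \<partial>lborel)"
      by (subst nn_integral_flip_on[OF a, where e = e]) (simp_all add: flip_on_flip_on[OF a])
  qed
  also have "\<dots> = (\<integral>\<^sup>+t. (\<Sum>e\<in>UNIV. ennreal (flip_jacobian a e t) * (f (flip_on a e t) * (orbit_weight a f t * g t))) \<partial>lborel)"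
    by (rule nn_integral_sum[symmetric]) measurable
  also have "\<dots> = (\<integral>\<^sup>+t. f t * g t \<partial>lborel)"
  proof (rule nn_integral_cong_AE, use AE_fin in eventually_elim)
    case (elim t)
    have "(\<Sum>e\<in>UNIV. ennreal (flip_jacobian a e t) * (f (flip_on a e t) * (orbit_weight a f t * g t)))
      = (\<Sum>e\<in>UNIV. ennreal (flip_jacobian a e t) * f (flip_on a e t)) * orbit_weight a f t * g t"
      by (simp add: sum_distrib_right mult.assoc)
    also have "\<dots> = f t * g t" using orbit_weight_sum[OF a, of f t] elim by simp
    finally show ?case .
  qed
  finally show ?thesis .
qed

section \<open>Equality in law of \<open>\<tau>\<close> and the randomised root vector\<close>

theorem theorem1:
  fixes M :: "'a measure" and P :: "'b measure"
    and W X :: "real \<Rightarrow> 'a \<Rightarrow> real ^ 'n"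
    and \<mu> \<sigma> x b :: "real ^ 'n"
    and \<tau> :: "'a \<Rightarrow> real ^ 'n"
    and f :: "real ^ 'n \<Rightarrow> ennreal"
    and Chi2 :: "'b \<Rightarrow> real ^ 'n"
    and I :: "('n \<Rightarrow> nat) \<Rightarrow> real ^ 'n \<Rightarrow> real set"
    and U :: "'b \<Rightarrow> real"
  assumes dim: "CARD('n) \<ge> 2"
    and W: "correlated_brownian_motion M W"
    and X: "X = drifted_bm \<mu> \<sigma> x W"
    and vol: "\<And>k. \<sigma> $ k > 0"
    and corr: "\<And>i j t. i \<noteq> j \<Longrightarrow> 0 < t \<Longrightarrow> \<bar>corr M (\<lambda>\<omega>. X t \<omega> $ i) (\<lambda>\<omega>. X t \<omega> $ j)\<bar> < 1"
    and level: "\<And>k. b $ k \<noteq> x $ k"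
    and drift: "\<And>k. \<mu> $ k / (b $ k - x $ k) \<ge> 0"
    and \<tau>: "\<tau> = hitting_times X b"
    and density: "distributed M lborel \<tau> f"
    and P: "prob_space P"
    and Chi2_rv: "Chi2 \<in> borel_measurable P"
    and Chi2_marginals: "\<And>k. distr P borel (\<lambda>\<omega>. Chi2 \<omega> $ k) = chi_square_1"
    and Chi2_law: "distr P borel Chi2 =
      distr M borel (\<lambda>\<omega>. \<chi> k. H (\<mu> $ k) (\<sigma> $ k) (b $ k - x $ k) (\<tau> \<omega> $ k))"
    and I_measurable: "\<And>u. u \<in> multi_indices \<Longrightarrow>
      {(y, s). s \<in> I u y} \<in> sets (borel \<Otimes>\<^sub>M borel)"
    and I_disjoint: "\<And>\<omega>. \<omega> \<in> space P \<Longrightarrow> disjoint_family_on (\<lambda>u. I u (Chi2 \<omega>)) multi_indices"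
    and I_cover: "\<And>\<omega>. \<omega> \<in> space P \<Longrightarrow> (\<Union>u\<in>multi_indices. I u (Chi2 \<omega>)) = {0..1}"
    and I_weight: "\<And>u. u \<in> multi_indices \<Longrightarrow>
      AE \<omega> in P. emeasure lborel (I u (Chi2 \<omega>)) = branch_weight \<mu> \<sigma> (b - x) f u (Chi2 \<omega>)"
    and U_rv: "U \<in> borel_measurable P"
    and U_uniform: "distr P lborel U = uniform_measure lborel {0<..<1}"
    and U_indep: "prob_space.indep_set P {Chi2 -` A \<inter> space P | A. A \<in> sets borel}
      {U -` B \<inter> space P | B. B \<in> sets borel}"
  shows "distr M borel \<tau> =
    distr P borel (\<lambda>\<omega>. \<Sum>u\<in>multi_indices.
      indicat_real (I u (Chi2 \<omega>)) (U \<omega>) *\<^sub>R root_vec \<mu> \<sigma> (b - x) u (Chi2 \<omega>))"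
proof (rule measure_eqI)
  fix A assume "A \<in> sets (distr M borel \<tau>)"
  then have A [measurable]: "A \<in> sets borel" by simp
  interpret M: prob_space M using W by (simp add: correlated_brownian_motion_def)
  interpret P: prob_space P by (rule P)
  define c where "c = b - x"
  define a :: "real ^ 'n" where "a = (\<chi> k. (c $ k / \<mu> $ k)\<^sup>2)"
  define Hv :: "real ^ 'n \<Rightarrow> real ^ 'n" where "Hv t = (\<chi> k. H (\<mu> $ k) (\<sigma> $ k) (c $ k) (t $ k))" for t
  \<comment> \<open>For positive \<open>y\<close>, \<open>g (root_vec \<mu> \<sigma> c u y)\<close>
    will be the conditional probability, given \<open>Chi2 = y\<close>, that branch \<open>u\<close>
    is chosen and its point lies in \<open>A\<close>.\<close>
  define g where "g t = orbit_weight a f t * indicator A t" for t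
  have c: "0 \<le> \<mu> $ k / c $ k" "c $ k \<noteq> 0" for k
    using drift[of k] level[of k] by (simp_all add: c_def)
  have a: "0 \<le> a $ k" for k by (simp add: a_def)
  have f [measurable]: "f \<in> borel_measurable borel"
    using distributed_borel_measurable[OF density] by simp
  have \<tau>_rv [measurable]: "\<tau> \<in> borel_measurable M"
    using distributed_measurable[OF density] by simp
  have g [measurable]: "g \<in> borel_measurable borel" unfolding g_def[abs_def] by measurable
  have Hv [measurable]: "Hv \<in> borel_measurable borel"
    unfolding Hv_def[abs_def] H_def[abs_def] by (rule vec_lambda_measurable) measurable
  note [measurable] = Chi2_rv U_rv
  have \<tau>_neq: "AE \<omega> in M. \<tau> \<omega> $ k \<noteq> v" for k v
  proof (rule AE_distrD[of \<tau> M lborel])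
    show "AE t in distr M lborel \<tau>. t $ k \<noteq> v"
      unfolding distributed_distr_eq_density[OF density]
      using AE_lborel_vec_nth_neq[of k v] by (subst AE_density) (auto elim: eventually_mono)
  qed simp
  have \<tau>_pos: "AE \<omega> in M. \<forall>k. 0 < \<tau> \<omega> $ k"
    unfolding AE_all_countable
  proof
    fix k
    \<comment> \<open>Avoiding \<open>Inf {}\<close> makes the set of hitting times nonempty;
      avoiding 0 makes the bound \<open>0 \<le> Inf S\<close> strict.\<close>
    show "AE \<omega> in M. 0 < \<tau> \<omega> $ k"
      using \<tau>_neq[of k 0] \<tau>_neq[of k "Inf {}"]
    proof eventually_elim
      case (elim \<omega>)
      define S where "S = {t. 0 < t \<and> X t \<omega> $ k = b $ k}"
      have \<tau>S: "\<tau> \<omega> $ k = Inf S" by (simp add: \<tau> hitting_times_def S_def)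
      then have "S \<noteq> {}" using elim by auto
      then have "0 \<le> Inf S" by (rule cInf_greatest) (auto simp: S_def)
      then show ?case using elim \<tau>S by simp
    qed
  qed
  \<comment> \<open>For \<open>\<mu> $ k \<noteq> 0\<close> the excluded value
    \<open>c $ k / \<mu> $ k\<close> is the zero of \<open>H\<close>. For
    \<open>\<mu> $ k = 0\<close> the inequality only says \<open>c $ k \<noteq> 0\<close>.\<close>
  have regular: "AE \<omega> in M. \<forall>k. 0 < \<tau> \<omega> $ k \<and> \<mu> $ k * \<tau> \<omega> $ k \<noteq> c $ k"
  proof -
    have "AE \<omega> in M. \<forall>k. \<tau> \<omega> $ k \<noteq> c $ k / \<mu> $ k"
      unfolding AE_all_countable using \<tau>_neq by blast
    with \<tau>_pos show ?thesis
    proof eventually_elim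
      case (elim \<omega>)
      have "\<mu> $ k * \<tau> \<omega> $ k \<noteq> c $ k" for k
        using elim(2)[THEN spec, of k] c(2)[of k] by (cases "\<mu> $ k = 0") (auto simp: nonzero_eq_divide_eq mult.commute)
      then show ?case using elim by blast
    qed
  qed
  have law: "distr P borel Chi2 = distr M borel (\<lambda>\<omega>. Hv (\<tau> \<omega>))"
    using Chi2_law by (simp add: Hv_def c_def)
  \<comment> \<open>Positivity is known for \<open>Hv (\<tau> \<omega>)\<close> on \<open>M\<close>
    and passes to \<open>P\<close> through the equality of laws.\<close>
  have Chi2_pos: "AE \<omega> in P. \<forall>k. 0 < Chi2 \<omega> $ k"
  proof (rule AE_distrD[OF Chi2_rv])
    have "AE \<omega> in M. \<forall>k. 0 < Hv (\<tau> \<omega>) $ k"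
      using regular
    proof eventually_elim
      case (elim \<omega>)
      then show ?case using root_of_H(1)[OF c vol] by (simp add: Hv_def)
    qed
    then show "AE y in distr P borel Chi2. \<forall>k. 0 < y $ k"
      unfolding law by (subst AE_distr_iff) simp_all
  qed
  define Z where "Z \<omega> = (\<Sum>u\<in>multi_indices. indicat_real (I u (Chi2 \<omega>)) (U \<omega>) *\<^sub>R root_vec \<mu> \<sigma> c u (Chi2 \<omega>))" for \<omega>
  have [measurable]: "(\<lambda>\<omega>. indicat_real (I u (Chi2 \<omega>)) (U \<omega>)) \<in> borel_measurable P"
      "(\<lambda>\<omega>. indicator (I u (Chi2 \<omega>)) (U \<omega>) :: ennreal) \<in> borel_measurable P" if "u \<in> multi_indices" for u
  proof -
    define K where "K = {(y, s). s \<in> I u y}"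
    have [measurable]: "K \<in> sets (borel \<Otimes>\<^sub>M borel)" using I_measurable[OF that] by (simp add: K_def)
    have "(\<lambda>\<omega>. indicat_real K (Chi2 \<omega>, U \<omega>)) \<in> borel_measurable P"
      "(\<lambda>\<omega>. indicator K (Chi2 \<omega>, U \<omega>) :: ennreal) \<in> borel_measurable P" by measurable
    then show "(\<lambda>\<omega>. indicat_real (I u (Chi2 \<omega>)) (U \<omega>)) \<in> borel_measurable P"
      "(\<lambda>\<omega>. indicator (I u (Chi2 \<omega>)) (U \<omega>) :: ennreal) \<in> borel_measurable P"
      by (simp_all add: K_def indicator_def)
  qed
  have Z [measurable]: "Z \<in> borel_measurable P" unfolding Z_def[abs_def] by measurable
  have "AE \<omega> in P. U \<omega> \<in> {0<..<1}"
  proof (rule AE_distrD[of U P lborel])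
    show "AE s in distr P lborel U. s \<in> {0<..<1}"
      unfolding U_uniform by (rule AE_uniform_measureI) simp_all
  qed simp
  \<comment> \<open>Almost surely \<open>U\<close> lies in exactly one cell of the partition, so
    \<open>Z\<close> is a single root vector and its indicator is the sum of the branchwise
    ones.\<close>
  then have Z_indicator: "AE \<omega> in P. indicator A (Z \<omega>) =
      (\<Sum>u\<in>multi_indices. indicator (I u (Chi2 \<omega>)) (U \<omega>) * indicator A (root_vec \<mu> \<sigma> c u (Chi2 \<omega>)) :: ennreal)"
    using AE_space
  proof eventually_elim
    case (elim \<omega>)
    have "U \<omega> \<in> (\<Union>u\<in>multi_indices. I u (Chi2 \<omega>))" using elim by (simp add: I_cover)
    then obtain u0 where u0: "u0 \<in> multi_indices" "U \<omega> \<in> I u0 (Chi2 \<omega>)" by blast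
    have iff: "U \<omega> \<in> I u (Chi2 \<omega>) \<longleftrightarrow> u = u0" if "u \<in> multi_indices" for u
      using disjoint_family_onD[OF I_disjoint[OF elim(2)] that u0(1)] u0 by blast
    have "Z \<omega> = (\<Sum>u\<in>multi_indices. if u = u0 then root_vec \<mu> \<sigma> c u (Chi2 \<omega>) else 0)"
      unfolding Z_def by (rule sum.cong) (auto simp: iff)
    moreover have "(\<Sum>u\<in>multi_indices. indicator (I u (Chi2 \<omega>)) (U \<omega>) * indicator A (root_vec \<mu> \<sigma> c u (Chi2 \<omega>)) :: ennreal)
        = (\<Sum>u\<in>multi_indices. if u = u0 then indicator A (root_vec \<mu> \<sigma> c u (Chi2 \<omega>)) else 0)"
      by (rule sum.cong) (auto simp: iff)
    ultimately show ?case using u0 by (simp add: finite_multi_indices)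
  qed
  \<comment> \<open>Integrating out \<open>U\<close> turns the cell into its length, which is the
    branch weight; the equality of laws then moves the integral from \<open>P\<close> to
    \<open>M\<close>.\<close>
  have branch: "(\<integral>\<^sup>+\<omega>. indicator (I u (Chi2 \<omega>)) (U \<omega>) * indicator A (root_vec \<mu> \<sigma> c u (Chi2 \<omega>)) \<partial>P)
      = (\<integral>\<^sup>+\<omega>. g (root_vec \<mu> \<sigma> c u (Hv (\<tau> \<omega>))) \<partial>M)" if u: "u \<in> multi_indices" for u
  proof -
    have "(\<integral>\<^sup>+\<omega>. indicator (I u (Chi2 \<omega>)) (U \<omega>) * indicator A (root_vec \<mu> \<sigma> c u (Chi2 \<omega>)) \<partial>P)
        = (\<integral>\<^sup>+\<omega>. emeasure lborel (I u (Chi2 \<omega>)) * indicator A (root_vec \<mu> \<sigma> c u (Chi2 \<omega>)) \<partial>P)"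
      by (rule P.nn_integral_indep_uniform[OF Chi2_rv U_rv U_uniform U_indep I_measurable[OF u]])
        (use I_cover u in \<open>blast, measurable\<close>)
    also have "\<dots> = (\<integral>\<^sup>+\<omega>. g (root_vec \<mu> \<sigma> c u (Chi2 \<omega>)) \<partial>P)"
    proof (rule nn_integral_cong_AE, use Chi2_pos I_weight[OF u] in eventually_elim)
      case (elim \<omega>)
      then show ?case
        using branch_weight_eq_orbit_weight[OF c vol _ u, of "Chi2 \<omega>" f]
        by (simp add: g_def a_def c_def)
    qed
    also have "\<dots> = (\<integral>\<^sup>+y. g (root_vec \<mu> \<sigma> c u y) \<partial>distr P borel Chi2)"
      by (rule nn_integral_distr[symmetric]) measurable
    also have "\<dots> = (\<integral>\<^sup>+\<omega>. g (root_vec \<mu> \<sigma> c u (Hv (\<tau> \<omega>))) \<partial>M)"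
      unfolding law by (rule nn_integral_distr) measurable
    finally show ?thesis .
  qed
  have "emeasure (distr P borel Z) A = (\<integral>\<^sup>+\<omega>. indicator A (Z \<omega>) \<partial>P)"
    using nn_integral_distr[OF Z, of "indicator A"] by simp
  also have "\<dots> = (\<integral>\<^sup>+\<omega>. (\<Sum>u\<in>multi_indices. indicator (I u (Chi2 \<omega>)) (U \<omega>) * indicator A (root_vec \<mu> \<sigma> c u (Chi2 \<omega>))) \<partial>P)"
    using Z_indicator by (rule nn_integral_cong_AE)
  also have "\<dots> = (\<Sum>u\<in>multi_indices. \<integral>\<^sup>+\<omega>. indicator (I u (Chi2 \<omega>)) (U \<omega>) * indicator A (root_vec \<mu> \<sigma> c u (Chi2 \<omega>)) \<partial>P)"
    by (rule nn_integral_sum) measurable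
  also have "\<dots> = (\<Sum>u\<in>multi_indices. \<integral>\<^sup>+\<omega>. g (root_vec \<mu> \<sigma> c u (Hv (\<tau> \<omega>))) \<partial>M)"
    using branch by (rule sum.cong[OF refl])
  also have "\<dots> = (\<integral>\<^sup>+\<omega>. (\<Sum>u\<in>multi_indices. g (root_vec \<mu> \<sigma> c u (Hv (\<tau> \<omega>)))) \<partial>M)"
    by (rule nn_integral_sum[symmetric]) measurable
  \<comment> \<open>Over all branches, the root vectors of \<open>Hv (\<tau> \<omega>)\<close> run
    through the flips of \<open>\<tau> \<omega>\<close>, so the integral can be written with the
    density \<open>f\<close>.\<close>
  also have "\<dots> = (\<integral>\<^sup>+\<omega>. (\<Sum>e\<in>UNIV. g (flip_on a e (\<tau> \<omega>))) \<partial>M)"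
  proof (rule nn_integral_cong_AE, use regular in eventually_elim)
    case (elim \<omega>)
    then show ?case
      using sum_root_vec_H[OF c vol, of "\<tau> \<omega>" g] by (simp add: Hv_def a_def)
  qed
  also have "\<dots> = (\<integral>\<^sup>+t. f t * (\<Sum>e\<in>UNIV. g (flip_on a e t)) \<partial>lborel)"
    by (rule distributed_nn_integral[OF density, symmetric]) measurable
  also have "\<dots> = (\<integral>\<^sup>+t. f t * indicator A t \<partial>lborel)"
    unfolding g_def
  proof (rule nn_integral_orbit_weight[OF a f])
    show "(\<integral>\<^sup>+t. f t \<partial>lborel) \<noteq> \<infinity>"
      using distributed_nn_integral[OF density, of "\<lambda>_. 1"] by (simp add: M.emeasure_space_1)
  qed measurable
  also have "\<dots> = (\<integral>\<^sup>+\<omega>. indicator A (\<tau> \<omega>) \<partial>M)"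
    by (rule distributed_nn_integral[OF density]) measurable
  also have "\<dots> = emeasure (distr M borel \<tau>) A"
    using nn_integral_distr[OF \<tau>_rv, of "indicator A"] by simp
  finally show "emeasure (distr M borel \<tau>) A = emeasure (distr P borel
      (\<lambda>\<omega>. \<Sum>u\<in>multi_indices. indicat_real (I u (Chi2 \<omega>)) (U \<omega>) *\<^sub>R root_vec \<mu> \<sigma> (b - x) u (Chi2 \<omega>))) A"
    by (simp add: Z_def[abs_def] c_def)
qed simp

end
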